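(* An element $g\in H(\mathbb{Z})$ is a dead end element (with respect to the generating set $S=\{a,b\}$) if and only if $g=[a,b]^k$ for some integer $k\neq 0$.
   Context: The discrete Heisenberg group is $H(\mathbb{Z}) = \left\{ \begin{pmatrix}1 & n & k \\ 0 & 1 & m\\ 0 & 0 & 1\end{pmatrix} : n,m,k \in \mathbb{Z}\right\}$, with presentation $\langle a,b \mid [[a,b],a]=1,\ [[a,b],b]=1\rangle$, where $a,b$ correspond to $\begin{pmatrix}1 & 1 & 0 \\ 0 & 1 & 0\\ 0 & 0 & 1\end{pmatrix}$ and $\begin{pmatrix}1 & 0 & 0 \\ 0 & 1 & 1\\ 0 & 0 & 1\end{pmatrix}$ respectively, and $[a,b]=aba^{-1}b^{-1}$. Put $S=\{a,b\}$ and $S^{-1}=\{a^{-1},b^{-1}\}$. For $g\in H(\mathbb{Z})$, $l(g)$ is the distance from $1$ to $g$ in the Cayley graph with respect to $S$, i.e. the least length of a word in the alphabet $S\cup S^{-1}$ representing $g$. An element $g$ is a dead end element if $l(gs)<l(g)$ for all $s\in S\cup S^{-1}$. *)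

theory Defs
  imports "HOL-Analysis.Analysis" "HOL-Algebra.Group"
begin

definition heis_mat :: "int \<Rightarrow> int \<Rightarrow> int \<Rightarrow> int^3^3" where
  "heis_mat n m k = vector [vector [1, n, k], vector [0, 1, m], vector [0, 0, 1]]"

definition heisenberg :: "(int^3^3) monoid" where
  "heisenberg = \<lparr>carrier = {heis_mat n m k | n m k. True}, mult = (**), one = mat 1\<rparr>"

definition heis_a :: "int^3^3" where
  "heis_a = heis_mat 1 0 0"

definition heis_b :: "int^3^3" where
  "heis_b = heis_mat 0 1 0"

text \<open>The convention is \<open>[x,y] = x y x\<inverse> y\<inverse>\<close>.\<close>

definition commutator :: "('a, 'c) monoid_scheme \<Rightarrow> 'a \<Rightarrow> 'a \<Rightarrow> 'a" where
  "commutator G x y =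
    x \<otimes>\<^bsub>G\<^esub> y \<otimes>\<^bsub>G\<^esub> inv\<^bsub>G\<^esub> x \<otimes>\<^bsub>G\<^esub> inv\<^bsub>G\<^esub> y"

definition sym_gens :: "('a, 'c) monoid_scheme \<Rightarrow> 'a set \<Rightarrow> 'a set" where
  "sym_gens G S = S \<union> (\<lambda>s. inv\<^bsub>G\<^esub> s) ` S"

definition word_value :: "('a, 'c) monoid_scheme \<Rightarrow> 'a list \<Rightarrow> 'a" where
  "word_value G w = foldr (\<lambda>x y. x \<otimes>\<^bsub>G\<^esub> y) w \<one>\<^bsub>G\<^esub>"

text \<open>
  The distance from the identity in the Cayley graph of \<open>G\<close> with respect to \<open>S\<close>.
  It is only meaningful for elements of the subgroup generated by \<open>S\<close>.
\<close>

definition word_length :: "('a, 'c) monoid_scheme \<Rightarrow> 'a set \<Rightarrow> 'a \<Rightarrow> nat" where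
  "word_length G S g =
    (LEAST n. \<exists>w. set w \<subseteq> sym_gens G S \<and> length w = n \<and> word_value G w = g)"

definition dead_end :: "('a, 'c) monoid_scheme \<Rightarrow> 'a set \<Rightarrow> 'a \<Rightarrow> bool" where
  "dead_end G S g \<longleftrightarrow>
    (\<forall>s \<in> sym_gens G S. word_length G S (g \<otimes>\<^bsub>G\<^esub> s) < word_length G S g)"

lemma heis_mat_mult:
  "heis_mat n m k ** heis_mat n' m' k' = heis_mat (n + n') (m + m') (k + k' + n * m')"
  by (simp add: heis_mat_def matrix_matrix_mult_def vec_eq_iff forall_3 sum_3)

lemma heis_mat_one: "heis_mat 0 0 0 = mat 1"
  by (simp add: heis_mat_def mat_def vec_eq_iff forall_3)

lemma group_heisenberg: "group heisenberg"
proof (rule groupI)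
  fix x assume "x \<in> carrier heisenberg"
  then obtain n m k where x: "x = heis_mat n m k"
    by (auto simp: heisenberg_def)
  have "heis_mat (- n) (- m) (n * m - k) ** x = mat 1"
    by (simp add: x heis_mat_mult flip: heis_mat_one)
  then show "\<exists>y \<in> carrier heisenberg. y \<otimes>\<^bsub>heisenberg\<^esub> x = \<one>\<^bsub>heisenberg\<^esub>"
    by (auto simp: heisenberg_def)
qed (auto simp: heisenberg_def heis_mat_mult matrix_mul_assoc simp flip: heis_mat_one, blast+)

end

(*
  A word in the generators traces a lattice path; the central coordinate of its value is an area
  swept by the path. Among the words with p letters a and q letters b that end over (x,y) with
  0 \<le> x \<le> p and 0 \<le> y \<le> q, that area is at most pq, and every value from 0 to pq occurs.
  Up to the symmetries of the generating set one may assume x, y \<ge> 0 and 2z \<ge> xy, and then the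
  length of (x,y,z) is the minimum of 2(p + q) - x - y subject to p \<ge> x, q \<ge> y, pq \<ge> z.
  Over the origin, moving the endpoint to (1,0) keeps p and q admissible and gains 1. Away from the
  origin with x \<ge> 1, the length increases along a if z \<le> xy, and along inverse a or along b if z > xy.
*)

theory Submission
  imports Defs
begin

section \<open>Words in coordinates\<close>

text \<open>The rules are the left multiplications by the four letters.\<close>

inductive heis_reach :: "nat \<Rightarrow> int \<Rightarrow> int \<Rightarrow> int \<Rightarrow> bool" where
  one: "heis_reach 0 0 0 0"
| a: "heis_reach n x y z \<Longrightarrow> heis_reach (Suc n) (x + 1) y (z + y)"
| inv_a: "heis_reach n x y z \<Longrightarrow> heis_reach (Suc n) (x - 1) y (z - y)"
| b: "heis_reach n x y z \<Longrightarrow> heis_reach (Suc n) x (y + 1) z"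
| inv_b: "heis_reach n x y z \<Longrightarrow> heis_reach (Suc n) x (y - 1) z"

definition heis_len :: "int \<Rightarrow> int \<Rightarrow> int \<Rightarrow> nat" where
  "heis_len x y z = (LEAST n. heis_reach n x y z)"

text \<open>Here the letters act on the right: moves along \<open>b\<close> shift the central
  coordinate by \<open>x\<close> and moves along \<open>a\<close> keep it, unlike the left
  multiplications in \<open>heis_reach\<close>.\<close>

definition heis_dead_end :: "int \<Rightarrow> int \<Rightarrow> int \<Rightarrow> bool" where
  "heis_dead_end x y z \<longleftrightarrow>
    heis_len (x + 1) y z < heis_len x y z \<and> heis_len (x - 1) y z < heis_len x y z \<and>
    heis_len x (y + 1) (z + x) < heis_len x y z \<and> heis_len x (y - 1) (z - x) < heis_len x y z"

lemma heis_mat_eq_iff: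
  "heis_mat n m k = heis_mat n' m' k' \<longleftrightarrow> n = n' \<and> m = m' \<and> k = k'"
  by (auto simp: heis_mat_def vec_eq_iff forall_3)

lemma heis_mat_carrier [simp]: "heis_mat n m k \<in> carrier heisenberg"
  by (auto simp: heisenberg_def)

lemma mult_heisenberg:
  "heis_mat n m k \<otimes>\<^bsub>heisenberg\<^esub> heis_mat n' m' k' = heis_mat (n + n') (m + m') (k + k' + n * m')"
  by (simp add: heisenberg_def heis_mat_mult)

lemma one_heisenberg: "\<one>\<^bsub>heisenberg\<^esub> = heis_mat 0 0 0"
  by (simp add: heisenberg_def heis_mat_one)

lemma inv_heisenberg: "inv\<^bsub>heisenberg\<^esub> (heis_mat n m k) = heis_mat (- n) (- m) (n * m - k)"
  by (rule group.inv_equality [OF group_heisenberg])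
     (simp_all add: mult_heisenberg one_heisenberg)

lemma sym_gens_heisenberg:
  "sym_gens heisenberg {heis_a, heis_b} =
    {heis_mat 1 0 0, heis_mat 0 1 0, heis_mat (- 1) 0 0, heis_mat 0 (- 1) 0}"
  by (auto simp: sym_gens_def heis_a_def heis_b_def inv_heisenberg)

lemma commutator_int_pow:
  "commutator heisenberg heis_a heis_b [^]\<^bsub>heisenberg\<^esub> (k::int) = heis_mat 0 0 k"
proof -
  have nat_pow: "heis_mat 0 0 1 [^]\<^bsub>heisenberg\<^esub> (n::nat) = heis_mat 0 0 (int n)" for n
    by (induction n) (simp_all add: nat_pow_def one_heisenberg mult_heisenberg add.commute)
  have "commutator heisenberg heis_a heis_b = heis_mat 0 0 1"
    by (simp add: commutator_def heis_a_def heis_b_def inv_heisenberg mult_heisenberg)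
  moreover have "heis_mat 0 0 1 [^]\<^bsub>heisenberg\<^esub> k = heis_mat 0 0 k"
    by (cases "k < 0") (simp_all add: int_pow_def2 nat_pow inv_heisenberg)
  ultimately show ?thesis by simp
qed

text \<open>\<open>word_value\<close> folds from the right, so putting a letter in front of a word
  is a left multiplication, which is one rule of \<open>heis_reach\<close>.\<close>

lemma heis_reach_iff_word:
  "heis_reach n x y z \<longleftrightarrow>
    (\<exists>w. set w \<subseteq> sym_gens heisenberg {heis_a, heis_b} \<and> length w = n \<and>
      word_value heisenberg w = heis_mat x y z)"
    (is "_ \<longleftrightarrow> (\<exists>w. ?P w n x y z)")
proof
  have cons: "\<exists>w. ?P w (Suc n) (i + x) (j + y) (z + i * y)"
    if "\<exists>w. ?P w n x y z" "heis_mat i j 0 \<in> sym_gens heisenberg {heis_a, heis_b}" for n i j x y z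
  proof -
    from that(1) obtain w where "?P w n x y z" by blast
    with that(2) have "?P (heis_mat i j 0 # w) (Suc n) (i + x) (j + y) (z + i * y)"
      by (simp add: word_value_def mult_heisenberg)
    then show ?thesis by blast
  qed
  assume "heis_reach n x y z"
  then show "\<exists>w. ?P w n x y z"
  proof induction
    case one
    then show ?case by (simp add: word_value_def one_heisenberg)
  next
    case (a n x y z)
    show ?case using cons [OF a.IH, of 1 0] by (simp add: sym_gens_heisenberg add.commute)
  next
    case (inv_a n x y z)
    show ?case using cons [OF inv_a.IH, of "- 1" 0] by (simp add: sym_gens_heisenberg)
  next
    case (b n x y z)
    show ?case using cons [OF b.IH, of 0 1] by (simp add: sym_gens_heisenberg add.commute)
  next
    case (inv_b n x y z)
    show ?case using cons [OF inv_b.IH, of 0 "- 1"] by (simp add: sym_gens_heisenberg)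
  qed
next
  have "\<exists>x y z. word_value heisenberg w = heis_mat x y z \<and> heis_reach (length w) x y z"
    if "set w \<subseteq> sym_gens heisenberg {heis_a, heis_b}" for w
    using that
  proof (induction w)
    case Nil
    then show ?case by (auto simp: word_value_def one_heisenberg intro: heis_reach.one)
  next
    case (Cons s w)
    then obtain x y z where w: "word_value heisenberg w = heis_mat x y z" "heis_reach (length w) x y z"
      by auto
    have val: "word_value heisenberg (s # w) = s \<otimes>\<^bsub>heisenberg\<^esub> heis_mat x y z"
      using w(1) by (simp add: word_value_def)
    from Cons.prems have "s \<in> {heis_mat 1 0 0, heis_mat 0 1 0, heis_mat (- 1) 0 0, heis_mat 0 (- 1) 0}"
      by (simp add: sym_gens_heisenberg)
    then show ?case
      unfolding val using heis_reach.intros(2-5) [OF w(2)]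
      by (auto simp: mult_heisenberg heis_mat_eq_iff add.commute)
  qed
  then show "heis_reach n x y z" if "\<exists>w. ?P w n x y z"
    using that by (metis heis_mat_eq_iff)
qed

lemma word_length_heisenberg:
  "word_length heisenberg {heis_a, heis_b} (heis_mat x y z) = heis_len x y z"
  by (simp add: word_length_def heis_len_def heis_reach_iff_word)

lemma dead_end_heisenberg:
  "dead_end heisenberg {heis_a, heis_b} (heis_mat x y z) \<longleftrightarrow> heis_dead_end x y z"
  by (auto simp: dead_end_def heis_dead_end_def sym_gens_heisenberg mult_heisenberg
      word_length_heisenberg)

section \<open>Symmetries\<close>

text \<open>Comes from the automorphism that inverts \<open>a\<close> and fixes \<open>b\<close>; it
  permutes the four letters.\<close>

lemma heis_reach_flipD: "heis_reach n x y z \<Longrightarrow> heis_reach n (- x) y (- z)"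
proof (induction rule: heis_reach.induct)
  case (a n x y z)
  then show ?case using heis_reach.inv_a [OF a.IH] by simp
next
  case (inv_a n x y z)
  then show ?case using heis_reach.a [OF inv_a.IH] by (simp add: add.commute)
qed (auto intro: heis_reach.one heis_reach.b heis_reach.inv_b)

text \<open>Exchanging \<open>a\<close> and \<open>b\<close> inverts \<open>[a,b]\<close>. Since
  \<open>(x,y,z)\<close> is \<open>b^y a^x [a,b]^z\<close>, its image is
  \<open>a^y b^x [a,b]^(-z)\<close>, with central coordinate \<open>x * y - z\<close>.\<close>

lemma heis_reach_swapD: "heis_reach n x y z \<Longrightarrow> heis_reach n y x (x * y - z)"
proof (induction rule: heis_reach.induct)
  case (a n x y z)
  then show ?case using heis_reach.b [OF a.IH] by (simp add: algebra_simps)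
next
  case (inv_a n x y z)
  then show ?case using heis_reach.inv_b [OF inv_a.IH] by (simp add: algebra_simps)
next
  case (b n x y z)
  then show ?case using heis_reach.a [OF b.IH] by (simp add: algebra_simps)
next
  case (inv_b n x y z)
  then show ?case using heis_reach.inv_a [OF inv_b.IH] by (simp add: algebra_simps)
qed (simp add: heis_reach.one)

lemma heis_reach_flip: "heis_reach n (- x) y (- z) \<longleftrightarrow> heis_reach n x y z"
  using heis_reach_flipD [of n x y z] heis_reach_flipD [of n "- x" y "- z"] by auto

lemma heis_reach_swap: "heis_reach n y x (x * y - z) \<longleftrightarrow> heis_reach n x y z"
  using heis_reach_swapD [of n x y z] heis_reach_swapD [of n y x "x * y - z"]
  by (auto simp: mult.commute)

text \<open>Inverting \<open>b\<close> is the flip conjugated by the swap.\<close>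

lemma heis_reach_flip': "heis_reach n x (- y) (- z) \<longleftrightarrow> heis_reach n x y z"
  using heis_reach_swap [of n y x z] heis_reach_flip [of n y x "x * y - z"]
    heis_reach_swap [of n x "- y" "z - x * y"]
  by (simp add: algebra_simps)

lemma heis_len_flip: "heis_len (- x) y (- z) = heis_len x y z"
  by (simp add: heis_len_def heis_reach_flip)

lemma heis_len_swap: "heis_len y x (x * y - z) = heis_len x y z"
  by (simp add: heis_len_def heis_reach_swap)

lemma heis_len_flip': "heis_len x (- y) (- z) = heis_len x y z"
  by (simp add: heis_len_def heis_reach_flip')

lemma heis_dead_end_flip: "heis_dead_end (- x) y (- z) \<longleftrightarrow> heis_dead_end x y z"
proof -
  have "heis_len (- x + 1) y (- z) = heis_len (x - 1) y z"
    "heis_len (- x - 1) y (- z) = heis_len (x + 1) y z"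
    "heis_len (- x) (y + 1) (- z + - x) = heis_len x (y + 1) (z + x)"
    "heis_len (- x) (y - 1) (- z - - x) = heis_len x (y - 1) (z - x)"
    using heis_len_flip [of "x - 1" y z] heis_len_flip [of "x + 1" y z]
      heis_len_flip [of x "y + 1" "z + x"] heis_len_flip [of x "y - 1" "z - x"]
    by simp_all
  then show ?thesis unfolding heis_dead_end_def heis_len_flip by auto
qed

lemma heis_dead_end_swap: "heis_dead_end y x (x * y - z) \<longleftrightarrow> heis_dead_end x y z"
  using heis_len_swap [of y x z] heis_len_swap [of y "x + 1" z] heis_len_swap [of y "x - 1" z]
    heis_len_swap [of "y + 1" x "z + x"] heis_len_swap [of "y - 1" x "z - x"]
  by (auto simp: heis_dead_end_def algebra_simps)

lemma heis_dead_end_flip': "heis_dead_end x (- y) (- z) \<longleftrightarrow> heis_dead_end x y z"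
  using heis_dead_end_swap [of y x z] heis_dead_end_flip [of y x "x * y - z"]
    heis_dead_end_swap [of x "- y" "z - x * y"]
  by (simp add: algebra_simps)

section \<open>Word length\<close>

lemma heis_reach_a_power: "heis_reach n x y z \<Longrightarrow> heis_reach (n + k) (x + int k) y (z + int k * y)"
proof (induction k)
  case (Suc k)
  show ?case using heis_reach.a [OF Suc.IH [OF Suc.prems]] by (simp add: algebra_simps)
qed simp

lemma heis_reach_inv_a_power: "heis_reach n x y z \<Longrightarrow> heis_reach (n + k) (x - int k) y (z - int k * y)"
proof (induction k)
  case (Suc k)
  show ?case using heis_reach.inv_a [OF Suc.IH [OF Suc.prems]] by (simp add: algebra_simps)
qed simp

lemma heis_reach_b_power: "heis_reach n x y z \<Longrightarrow> heis_reach (n + k) x (y + int k) z"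
proof (induction k)
  case (Suc k)
  show ?case using heis_reach.b [OF Suc.IH [OF Suc.prems]] by (simp add: algebra_simps)
qed simp

lemma heis_reach_inv_b_power: "heis_reach n x y z \<Longrightarrow> heis_reach (n + k) x (y - int k) z"
proof (induction k)
  case (Suc k)
  show ?case using heis_reach.inv_b [OF Suc.IH [OF Suc.prems]] by (simp add: algebra_simps)
qed simp

lemma heis_reach_exists:
  assumes "0 \<le> x" "x \<le> p" "0 \<le> y" "y \<le> q" "0 \<le> z" "z \<le> p * q"
  shows "heis_reach (nat (2 * (p + q) - x - y)) x y z"
proof (cases "z = p * q")
  case True
  \<comment> \<open>The inverse letters \<open>a\<close> come at height 0 and sweep nothing; all
    \<open>p\<close> letters \<open>a\<close> come at height \<open>q\<close>.\<close>
  have "heis_reach (0 + nat (p - x) + nat q + nat p + nat (q - y)) x y z"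
    using heis_reach_inv_b_power [OF heis_reach_a_power [OF heis_reach_b_power
      [OF heis_reach_inv_a_power [OF heis_reach.one]]], of "nat (p - x)" "nat q" "nat p" "nat (q - y)"]
      assms True by simp
  moreover have "0 + nat (p - x) + nat q + nat p + nat (q - y) = nat (2 * (p + q) - x - y)"
    unfolding of_nat_eq_iff [where 'a = int, symmetric] using assms by simp
  ultimately show ?thesis by simp
next
  case False
  \<comment> \<open>Put \<open>p - r\<close> letters \<open>a\<close> at height \<open>i\<close> and
    \<open>r\<close> at height \<open>i + 1\<close>: the area is \<open>p * i + r = z\<close>.
    Height \<open>i + 1\<close> is available because \<open>z < p * q\<close> gives
    \<open>i < q\<close>.\<close>
  define i where "i = z div p"
  define r where "r = z mod p"
  have "z < p * q" using False assms by simp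
  then have "p > 0" using assms by (cases "p = 0") auto
  have "0 \<le> i" "0 \<le> r" "r < p" "z = p * i + r"
    using \<open>p > 0\<close> assms by (simp_all add: i_def r_def pos_imp_zdiv_nonneg_iff)
  moreover from this have "p * i < p * q" using \<open>z < p * q\<close> by linarith
  then have "i < q" using \<open>p > 0\<close> by simp
  ultimately have "heis_reach (0 + nat (p - x) + nat i + nat (p - r) + 1 + nat r + nat (q - i - 1) + nat (q - y)) x y z"
    using heis_reach_inv_b_power [OF heis_reach_b_power [OF heis_reach_a_power [OF heis_reach_b_power
      [OF heis_reach_a_power [OF heis_reach_b_power [OF heis_reach_inv_a_power [OF heis_reach.one]]]]]],
      of "nat (p - x)" "nat i" "nat (p - r)" 1 "nat r" "nat (q - i - 1)" "nat (q - y)"]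
      assms \<open>i < q\<close> by (simp add: algebra_simps)
  moreover have "0 + nat (p - x) + nat i + nat (p - r) + 1 + nat r + nat (q - i - 1) + nat (q - y)
      = nat (2 * (p + q) - x - y)"
    unfolding of_nat_eq_iff [where 'a = int, symmetric]
    using assms \<open>0 \<le> i\<close> \<open>i < q\<close> \<open>0 \<le> r\<close> \<open>r < p\<close> by simp
  ultimately show ?thesis by simp
qed

lemma heis_len_le:
  assumes "0 \<le> x" "x \<le> p" "0 \<le> y" "y \<le> q" "0 \<le> z" "z \<le> p * q"
  shows "int (heis_len x y z) \<le> 2 * (p + q) - x - y"
proof -
  have "heis_len x y z \<le> nat (2 * (p + q) - x - y)"
    unfolding heis_len_def by (intro Least_le heis_reach_exists assms)
  then show ?thesis using assms by (simp add: le_nat_iff)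
qed

section \<open>Lower bounds on the length from the area\<close>

text \<open>Here \<open>p\<close> and \<open>q\<close> count the letters \<open>a\<close> and \<open>b\<close>, and the second coordinates of the suffixes
  of the word range over the interval from \<open>- v\<close> to \<open>u\<close>.\<close>

lemma heis_reach_area:
  assumes "heis_reach n x y z"
  shows "\<exists>p q u v. 0 \<le> p \<and> x \<le> p \<and> 0 \<le> u \<and> 0 \<le> v \<and> - v \<le> y \<and> y \<le> u \<and>
    int n = 2 * (p + q) - x - y \<and> u + v \<le> max q (q - y) \<and> z \<le> p * u + (p - x) * v"
    (is "\<exists>p q u v. ?P n x y z p q u v")
  using assms
proof induction
  case one
  have "?P 0 0 0 0 0 0 0 0" by simp
  then show ?case by blast
next
  case (a n x y z)
  then obtain p q u v where "?P n x y z p q u v" by blast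
  \<comment> \<open>The new letter adds \<open>y\<close>, which is at most \<open>u\<close>; in the
    next case the gain \<open>- y\<close> is at most \<open>v\<close>.\<close>
  then have "?P (Suc n) (x + 1) y (z + y) (p + 1) q u v" by (auto simp: algebra_simps)
  then show ?case by blast
next
  case (inv_a n x y z)
  then obtain p q u v where "?P n x y z p q u v" by blast
  then have "?P (Suc n) (x - 1) y (z - y) p q u v" by (auto simp: algebra_simps)
  then show ?case by blast
next
  case (b n x y z)
  then obtain p q u v where P: "?P n x y z p q u v" by blast
  \<comment> \<open>The interval grows upwards only if \<open>y = u \<ge> 0\<close>. Then
    \<open>max q (q - y)\<close> is \<open>q\<close>, which also grows by 1.\<close>
  have "p * u \<le> p * max u (y + 1)" using P by (intro mult_left_mono) auto
  then have "?P (Suc n) x (y + 1) z p (q + 1) (max u (y + 1)) v" using P by auto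
  then show ?case by blast
next
  case (inv_b n x y z)
  then obtain p q u v where P: "?P n x y z p q u v" by blast
  \<comment> \<open>Downward growth needs \<open>y = - v \<le> 0\<close>, where the maximum is
    \<open>q - y\<close>, and this grows by 1 as well.\<close>
  have "(p - x) * v \<le> (p - x) * max v (1 - y)" using P by (intro mult_left_mono) auto
  then have "?P (Suc n) x (y - 1) z p q u (max v (1 - y))" using P by auto
  then show ?case by blast
qed

text \<open>In this quadrant \<open>p - x \<le> p\<close> and \<open>max q (q - y) = q\<close>, so
  the two terms of the area estimate merge into \<open>p * (u + v) \<le> p * q\<close>.\<close>

lemma heis_reach_bound:
  assumes "heis_reach n x y z" "0 \<le> x" "0 \<le> y"
  obtains p q where "x \<le> p" "y \<le> q" "z \<le> p * q" "int n = 2 * (p + q) - x - y"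
proof -
  obtain p q u v where *: "0 \<le> p" "x \<le> p" "0 \<le> u" "0 \<le> v" "y \<le> u"
    "int n = 2 * (p + q) - x - y" "u + v \<le> max q (q - y)" "z \<le> p * u + (p - x) * v"
    using heis_reach_area [OF assms(1)] by blast
  have "(p - x) * v \<le> p * v" using * assms by (intro mult_right_mono) auto
  moreover have "p * (u + v) \<le> p * q" using * assms by (intro mult_left_mono) auto
  ultimately have "z \<le> p * q" using * by (simp add: distrib_left)
  moreover have "y \<le> q" using * assms by auto
  ultimately show ?thesis using that * by blast
qed

text \<open>The \<open>LEAST\<close> in \<open>heis_len\<close> is attained only if some word
  exists, so this amounts to the letters generating the group.\<close>

lemma heis_reach_heis_len: "heis_reach (heis_len x y z) x y z"
proof -
  have pos: "\<exists>n. heis_reach n x y z" if "0 \<le> x" "0 \<le> y" "0 \<le> z" for x y z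
  proof -
    have "0 \<le> x * y" "0 \<le> z * y" using that by simp_all
    then have "z \<le> (x + z) * (y + 1)" using that by (simp add: algebra_simps)
    then show ?thesis using heis_reach_exists [of x "x + z" y "y + 1" z] that by auto
  qed
  have quadrant: "\<exists>n. heis_reach n x y z" if "0 \<le> x" "0 \<le> y" for x y z
  proof (cases "0 \<le> z")
    case False
    moreover have "0 \<le> x * y" using that by simp
    ultimately have "0 \<le> x * y - z" by linarith
    then have "\<exists>n. heis_reach n y x (x * y - z)" using that by (intro pos)
    then show ?thesis by (simp only: heis_reach_swap)
  qed (rule pos [OF that])
  have half: "\<exists>n. heis_reach n x y z" if "0 \<le> y" for x y z
    using quadrant [of x y z] quadrant [of "- x" y "- z"] that
    by (cases "0 \<le> x") (simp_all only: heis_reach_flip)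
  have "\<exists>n. heis_reach n x y z"
    using half [of y x z] half [of "- y" x "- z"]
    by (cases "0 \<le> y") (simp_all only: heis_reach_flip')
  then show ?thesis unfolding heis_len_def by (metis LeastI_ex)
qed

lemma heis_len_ge:
  assumes "0 \<le> x" "0 \<le> y"
  shows "\<exists>p q. x \<le> p \<and> y \<le> q \<and> z \<le> p * q \<and> int (heis_len x y z) = 2 * (p + q) - x - y"
  using heis_reach_bound [OF heis_reach_heis_len assms] by metis

section \<open>Dead ends\<close>

lemma heis_dead_end_center_pos:
  assumes "0 < z"
  shows "heis_dead_end 0 0 z"
proof -
  obtain p q where pq: "0 \<le> p" "0 \<le> q" "z \<le> p * q" "int (heis_len 0 0 z) = 2 * (p + q)"
    using heis_len_ge [of 0 0 z] by auto
  have "1 \<le> p" using pq assms by (cases "p = 0") auto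
  then have "int (heis_len 1 0 z) \<le> 2 * (p + q) - 1 - 0"
    using pq assms by (intro heis_len_le) auto
  then have len: "heis_len 1 0 z < heis_len 0 0 z" using pq by linarith
  \<comment> \<open>Inverting \<open>b\<close> fixes \<open>(1,0)\<close> and negates
    \<open>z\<close>, so the sign of \<open>z\<close> is immaterial there; the flip and the swap
    then carry \<open>(1,0)\<close> to the other three neighbours.\<close>
  have "heis_len (- 1) 0 z = heis_len 1 0 z" "heis_len 0 1 z = heis_len 1 0 z"
    "heis_len 0 (- 1) z = heis_len 1 0 z"
    using heis_len_flip [of 1 0 "- z"] heis_len_flip [of 1 0 z] heis_len_flip' [of 1 0 z]
      heis_len_swap [of 1 0 "- z"] heis_len_swap [of 1 0 z] heis_len_flip' [of 0 1 "- z"]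
    by simp_all
  then show ?thesis using len by (simp add: heis_dead_end_def)
qed

lemma not_heis_dead_end_aux:
  assumes "1 \<le> x" "0 \<le> y" "x * y \<le> 2 * z"
  shows "\<not> heis_dead_end x y z"
proof
  assume "heis_dead_end x y z"
  then have
    a: "heis_len (x + 1) y z < heis_len x y z" and
    inv_a: "heis_len (x - 1) y z < heis_len x y z" and
    b: "heis_len x (y + 1) (z + x) < heis_len x y z"
    by (auto simp: heis_dead_end_def)
  have "0 \<le> x * y" using assms by simp
  then have "0 \<le> z" using assms(3) by linarith
  have le: "int (heis_len x y z) \<le> 2 * (p + q) - x - y" if "x \<le> p" "y \<le> q" "z \<le> p * q" for p q
    using that assms \<open>0 \<le> z\<close> by (intro heis_len_le) auto
  show False
  proof (cases "z \<le> x * y")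
    case True
    \<comment> \<open>The pair \<open>(x, y)\<close> is admissible for the element itself, giving
      length at most \<open>x + y\<close>, while the neighbour needs at least
      \<open>x + 1 + y\<close>.\<close>
    obtain p q where "x + 1 \<le> p" "y \<le> q" "int (heis_len (x + 1) y z) = 2 * (p + q) - (x + 1) - y"
      using heis_len_ge [of "x + 1" y z] assms by auto
    then show False using le [of x y] True a by simp
  next
    case False
    obtain p q where pq: "x - 1 \<le> p" "y \<le> q" "z \<le> p * q"
      "int (heis_len (x - 1) y z) = 2 * (p + q) - (x - 1) - y"
      using heis_len_ge [of "x - 1" y z] assms by auto
    \<comment> \<open>If \<open>p \<ge> x\<close>, the same pair would serve \<open>(x,y,z)\<close>
      with a length smaller by 1.\<close>
    have "p = x - 1"
    proof (rule ccontr)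
      assume "p \<noteq> x - 1"
      then show False using le [of p q] pq inv_a by simp
    qed
    have "y < q"
    proof (rule ccontr)
      assume "\<not> y < q"
      then have "q = y" using pq by simp
      moreover have "p * y \<le> x * y" using \<open>p = x - 1\<close> assms by (intro mult_right_mono) auto
      ultimately show False using pq False by simp
    qed
    \<comment> \<open>The pair \<open>(x, q - 1)\<close> has the same sum as
      \<open>(x - 1, q)\<close>, so it would again give a length smaller by 1.\<close>
    have less: "x * (q - 1) < z"
    proof (rule ccontr)
      assume "\<not> x * (q - 1) < z"
      then show False using le [of x "q - 1"] \<open>y < q\<close> \<open>p = x - 1\<close> pq inv_a by simp
    qed
    then have "q < x" using pq \<open>p = x - 1\<close> by (simp add: algebra_simps)
    have len: "int (heis_len x y z) \<le> 2 * (x + q) - x - y"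
      using \<open>p = x - 1\<close> pq \<open>y < q\<close> assms by (intro le) (auto simp: algebra_simps)
    obtain p' q' where pq': "x \<le> p'" "y + 1 \<le> q'" "z + x \<le> p' * q'"
      "int (heis_len x (y + 1) (z + x)) = 2 * (p' + q') - x - (y + 1)"
      using heis_len_ge [of x "y + 1" "z + x"] assms by auto
    define t where "t = p' - x"
    \<comment> \<open>By parity, the strict decrease along \<open>b\<close> forces
      \<open>p' + q' \<le> x + q\<close>. As \<open>q < x\<close>, enlarging \<open>p'\<close>
      beyond \<open>x\<close> only lowers the product, so \<open>z + x \<le> x * q\<close>, against
      \<open>less\<close>.\<close>
    have "0 \<le> t" "q' \<le> q - t" using pq' len b by (auto simp: t_def)
    have nonneg: "0 \<le> t * (x - q)" "0 \<le> t * t" using \<open>0 \<le> t\<close> \<open>q < x\<close> by simp_all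
    have "p' * q' \<le> (x + t) * (q - t)"
      unfolding t_def using \<open>q' \<le> q - t\<close> pq' assms by (intro mult_mono) (auto simp: t_def)
    also have "\<dots> = x * q - t * (x - q) - t * t" by (simp add: algebra_simps)
    also have "\<dots> \<le> x * q" using nonneg by linarith
    finally show False using pq' less by (simp add: algebra_simps)
  qed
qed

text \<open>The swap negates \<open>2 * z - x * y\<close>, which arranges the third hypothesis of
  \<open>not_heis_dead_end_aux\<close>. On an axis, a flip fixing the point of the plane adjusts the
  sign of \<open>z\<close>, so that the first coordinate can be made positive.\<close>

lemma not_heis_dead_end_quadrant:
  assumes "0 \<le> x" "0 \<le> y" "x \<noteq> 0 \<or> y \<noteq> 0"
  shows "\<not> heis_dead_end x y z"
proof (cases "x * y \<le> 2 * z")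
  case True
  show ?thesis
  proof (cases "x = 0")
    case True
    then show ?thesis
      using not_heis_dead_end_aux [of y 0 z] heis_dead_end_swap [of y 0 "- z"]
        heis_dead_end_flip [of 0 y z] assms \<open>x * y \<le> 2 * z\<close> by simp
  next
    case False
    then show ?thesis using not_heis_dead_end_aux [of x y z] True assms by simp
  qed
next
  case False
  show ?thesis
  proof (cases "y = 0")
    case True
    then show ?thesis
      using not_heis_dead_end_aux [of x 0 "- z"] heis_dead_end_flip' [of x 0 z] assms False by simp
  next
    case nz: False
    then show ?thesis
      using not_heis_dead_end_aux [of y x "x * y - z"] heis_dead_end_swap [of y x z] assms False
      by (simp add: mult.commute)
  qed
qed

lemma heis_dead_end_iff: "heis_dead_end x y z \<longleftrightarrow> x = 0 \<and> y = 0 \<and> z \<noteq> 0"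
proof (cases "x = 0 \<and> y = 0")
  case True
  have "heis_len 0 0 0 = 0"
    by (simp add: heis_len_def heis_reach.one)
  then have "\<not> heis_dead_end 0 0 0" by (simp add: heis_dead_end_def)
  moreover have "heis_dead_end 0 0 z" if "z \<noteq> 0"
    using that heis_dead_end_center_pos [of z] heis_dead_end_center_pos [of "- z"]
      heis_dead_end_flip [of 0 0 z] by (cases "0 < z") auto
  ultimately show ?thesis using True by auto
next
  case False
  \<comment> \<open>The central coordinate stays arbitrary because each flip used to remove an
    absolute value negates it.\<close>
  have "\<not> heis_dead_end \<bar>x\<bar> \<bar>y\<bar> w" for w
    using not_heis_dead_end_quadrant [of "\<bar>x\<bar>" "\<bar>y\<bar>" w] False by auto
  then have "\<not> heis_dead_end x \<bar>y\<bar> w" for w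
    using heis_dead_end_flip [of x "\<bar>y\<bar>" w] by (metis abs_if)
  then have "\<not> heis_dead_end x y z"
    using heis_dead_end_flip' [of x y z] by (metis abs_if)
  with False show ?thesis by blast
qed

theorem theorem1p3:
  fixes g :: "int^3^3"
  assumes "g \<in> carrier heisenberg"
  shows "dead_end heisenberg {heis_a, heis_b} g \<longleftrightarrow>
    (\<exists>k::int. k \<noteq> 0 \<and> g = commutator heisenberg heis_a heis_b [^]\<^bsub>heisenberg\<^esub> k)"
proof -
  obtain x y z where "g = heis_mat x y z"
    using assms by (auto simp: heisenberg_def)
  then show ?thesis
    by (auto simp: dead_end_heisenberg heis_dead_end_iff commutator_int_pow heis_mat_eq_iff)
qed

end
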